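(* Let $n\ge1$ and let $m=(m_0,\dots,m_n)$ be a sequence of non-negative integers. Define \[ X_m := R_{m_0,m_0}R_{m_0,m_1}L_{m_1,m_2}L_{m_2,m_3}\cdots L_{m_{n-1},m_n}. \] Then for all $1\le i\le m_0+1$ and $1\le j\le m_n+1$, the $(i,j)$-entry of $X_m$ equals the number of mixed dimer covers of $\mathcal{G}^z_n$ with labeling $(m_0+1-i,m_1,\dots,m_{n-1},m_n+1-j)$. In particular, the $(1,1)$-entry equals the number of mixed dimer covers of $\mathcal{G}^z_n$ with labeling $m$.
   Context: Mixed dimer covers: for a finite graph $\mathcal{G}=(V,E)$ and $\mathbf{n}\colon V\to\mathbb{N}$, a mixed dimer cover is a function $\omega\colon E\to\mathbb{N}$ with $\sum_{e\ni v}\omega(e)=\mathbf{n}(v)$ for each vertex $v$. Zigzag snake graph $\mathcal{G}^z_n$: union of unit squares $T_1,\dots,T_n$ with $T_{2j+1}$ having lower-left corner $(j,j)$ and $T_{2j}$ having lower-left corner $(j-1,j)$; vertices are the lattice points on the tiles, edges the unit sides. Its vertices are partitioned into pairs $P_0,\dots,P_n$: for $1\le k\le n$, if $k=2j+1$ then $P_{k-1}=\{(j,j),(j+1,j)\}$, if $k=2j$ then $P_{k-1}=\{(j-1,j),(j-1,j+1)\}$; $P_n$ is the remaining two vertices. The labeling $(x_0,\dots,x_n)$ gives both vertices of $P_i$ the value $x_i$ (a labeling with a negative entry admits no covers). $R_{a,b}$ is the $(a+1)\times(b+1)$ matrix with $(i,j)$-entry $1$ if $i+j\le b+2$ and $0$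 otherwise; $W$ is the $(a+1)\times(a+1)$ anti-diagonal matrix with $W_{ij}=1$ if $i+j=a+2$ and $0$ otherwise; $L_{a,b}:=WR_{a,b}$ (the rows of $R_{a,b}$ in reverse order). *)

theory Defs
  imports "Jordan_Normal_Form.Matrix" "HOL-Library.FuncSet"
begin

text \<open>A finite graph is given by its vertex set and its set of edges, an edge being a
  two-element set of vertices. Covers are taken in the extensional function space over the
  edge set, so that two covers are equal iff they agree on all edges.\<close>

definition mixed_dimer_covers ::
  "'v set \<Rightarrow> 'v set set \<Rightarrow> ('v \<Rightarrow> nat) \<Rightarrow> ('v set \<Rightarrow> nat) set" where
  "mixed_dimer_covers V E x =
     {\<omega> \<in> E \<rightarrow>\<^sub>E UNIV. \<forall>v\<in>V. (\<Sum>e\<in>{e \<in> E. v \<in> e}. \<omega> e) = x v}"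

lemma finite_mixed_dimer_covers:
  assumes E: "finite E" and inc: "\<And>e. e \<in> E \<Longrightarrow> e \<inter> V \<noteq> {}"
  shows "finite (mixed_dimer_covers V E x)"
proof -
  from inc have "\<exists>v. e \<in> E \<longrightarrow> v \<in> e \<and> v \<in> V" for e by blast
  then obtain w where w: "\<And>e. e \<in> E \<Longrightarrow> w e \<in> e \<and> w e \<in> V" by metis
  have "mixed_dimer_covers V E x \<subseteq> (\<Pi>\<^sub>E e\<in>E. {..x (w e)})"
  proof
    fix \<omega> assume \<omega>: "\<omega> \<in> mixed_dimer_covers V E x"
    have "\<omega> e \<le> x (w e)" if "e \<in> E" for e
    proof -
      have "\<omega> e \<le> (\<Sum>e'\<in>{e' \<in> E. w e \<in> e'}. \<omega> e')"
        using that w E by (intro member_le_sum) auto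
      then show ?thesis using \<omega> w[OF that] by (auto simp: mixed_dimer_covers_def)
    qed
    then show "\<omega> \<in> (\<Pi>\<^sub>E e\<in>E. {..x (w e)})"
      using \<omega> by (auto simp: mixed_dimer_covers_def PiE_iff)
  qed
  then show ?thesis by (rule finite_subset) (intro finite_PiE E, auto)
qed

text \<open>Lower-left corner of the tile \<open>T\<^sub>k\<close>; tiles are numbered from 1.\<close>

definition tile_corner :: "nat \<Rightarrow> int \<times> int" where
  "tile_corner k = (let j = int (k div 2) in if odd k then (j, j) else (j - 1, j))"

definition tile_vertices :: "nat \<Rightarrow> (int \<times> int) set" where
  "tile_vertices k = (case tile_corner k of (a, b) \<Rightarrow>
     {(a, b), (a + 1, b), (a, b + 1), (a + 1, b + 1)})"

definition tile_edges :: "nat \<Rightarrow> (int \<times> int) set set" where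
  "tile_edges k = (case tile_corner k of (a, b) \<Rightarrow>
     {{(a, b), (a + 1, b)}, {(a, b + 1), (a + 1, b + 1)},
      {(a, b), (a, b + 1)}, {(a + 1, b), (a + 1, b + 1)}})"

definition zigzag_vertices :: "nat \<Rightarrow> (int \<times> int) set" where
  "zigzag_vertices n = (\<Union>k\<in>{1..n}. tile_vertices k)"

definition zigzag_edges :: "nat \<Rightarrow> (int \<times> int) set set" where
  "zigzag_edges n = (\<Union>k\<in>{1..n}. tile_edges k)"

text \<open>The pair \<open>P\<^bsub>k-1\<^esub>\<close> attached to the tile \<open>T\<^sub>k\<close>.\<close>

definition tile_pair :: "nat \<Rightarrow> (int \<times> int) set" where
  "tile_pair k = (let j = int (k div 2) in
     if odd k then {(j, j), (j + 1, j)} else {(j - 1, j), (j - 1, j + 1)})"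

definition zigzag_pair :: "nat \<Rightarrow> nat \<Rightarrow> (int \<times> int) set" where
  "zigzag_pair n i =
     (if i < n then tile_pair (i + 1) else zigzag_vertices n - (\<Union>k\<in>{1..n}. tile_pair k))"

lemma zigzag_pairs_cover: "(\<Union>i\<le>n. zigzag_pair n i) = zigzag_vertices n"
proof -
  have sub: "tile_pair k \<subseteq> tile_vertices k" for k
    unfolding tile_pair_def tile_vertices_def tile_corner_def Let_def by simp
  have ivl: "{1..n} = Suc ` {..<n}" "{..n} = insert n {..<n}"
    by (rule image_Suc_lessThan[symmetric], auto)
  have "(\<Union>i\<in>{..<n}. zigzag_pair n i) = (\<Union>i\<in>{..<n}. tile_pair (Suc i))"
    by (intro SUP_cong) (simp_all add: zigzag_pair_def)
  then have "(\<Union>i\<le>n. zigzag_pair n i) =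
      zigzag_pair n n \<union> (\<Union>k\<in>{1..n}. tile_pair k)"
    by (simp only: ivl UN_insert image_image)
  also have "\<dots> = zigzag_vertices n \<union> (\<Union>k\<in>{1..n}. tile_pair k)"
    by (simp add: zigzag_pair_def)
  also have "\<dots> = zigzag_vertices n"
    unfolding zigzag_vertices_def by (intro Un_absorb2 UN_mono order_refl sub)
  finally show ?thesis .
qed

lemma zigzag_pairs_disjoint:
  assumes "i \<le> n" "j \<le> n" "i \<noteq> j"
  shows "zigzag_pair n i \<inter> zigzag_pair n j = {}"
proof -
  have D: "tile_pair k \<inter> tile_pair l = {}" if "k \<noteq> l" for k l
  proof -
    have ne: "int (k div 2) \<noteq> int (l div 2)" if "odd k \<longleftrightarrow> odd l"
      using that \<open>k \<noteq> l\<close> by presburger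
    define a b where "a = int (k div 2)" and "b = int (l div 2)"
    have tp: "tile_pair k = (if odd k then {(a, a), (a + 1, a)} else {(a - 1, a), (a - 1, a + 1)})"
      "tile_pair l = (if odd l then {(b, b), (b + 1, b)} else {(b - 1, b), (b - 1, b + 1)})"
      unfolding tile_pair_def Let_def a_def b_def by (rule refl)+
    have "a \<noteq> b" if "odd k \<longleftrightarrow> odd l" using ne that unfolding a_def b_def by blast
    then show ?thesis unfolding tp by (cases "odd k"; cases "odd l") auto
  qed
  have eq: "zigzag_pair n k = tile_pair (k + 1)" if "k < n" for k
    using that by (simp add: zigzag_pair_def)
  have eqn: "zigzag_pair n n = zigzag_vertices n - (\<Union>k\<in>{1..n}. tile_pair k)"
    by (simp add: zigzag_pair_def)
  have N: "zigzag_pair n k \<inter> zigzag_pair n n = {}" if "k < n" for k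
  proof -
    from that have "k + 1 \<in> {1..n}" by simp
    then show ?thesis unfolding eq[OF that] eqn by blast
  qed
  from assms consider "i < n" "j < n" | "i = n" "j < n" | "i < n" "j = n" by linarith
  then show ?thesis
  proof cases
    case 1
    with D[of "i + 1" "j + 1"] assms(3) show ?thesis by (simp add: eq)
  next
    case 2
    with N[of j] show ?thesis by blast
  next
    case 3
    with N[of i] show ?thesis by blast
  qed
qed

definition zigzag_label :: "nat \<Rightarrow> (nat \<Rightarrow> nat) \<Rightarrow> int \<times> int \<Rightarrow> nat" where
  "zigzag_label n x v = x (THE i. i \<le> n \<and> v \<in> zigzag_pair n i)"

lemma zigzag_label_eq:
  assumes "i \<le> n" "v \<in> zigzag_pair n i"
  shows "zigzag_label n x v = x i"
proof -
  have "(THE i. i \<le> n \<and> v \<in> zigzag_pair n i) = i"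
    using assms zigzag_pairs_disjoint[of _ n i] by (intro the_equality) blast+
  then show ?thesis by (simp add: zigzag_label_def)
qed

definition zigzag_covers :: "nat \<Rightarrow> (nat \<Rightarrow> nat) \<Rightarrow> ((int \<times> int) set \<Rightarrow> nat) set" where
  "zigzag_covers n x =
     mixed_dimer_covers (zigzag_vertices n) (zigzag_edges n) (zigzag_label n x)"

lemma finite_zigzag_covers: "finite (zigzag_covers n x)"
  unfolding zigzag_covers_def
proof (rule finite_mixed_dimer_covers)
  show "finite (zigzag_edges n)"
    by (auto simp: zigzag_edges_def tile_edges_def split: prod.splits)
  fix e assume "e \<in> zigzag_edges n"
  then obtain k where k: "k \<in> {1..n}" "e \<in> tile_edges k" by (auto simp: zigzag_edges_def)
  obtain a b where "tile_corner k = (a, b)" by (cases "tile_corner k")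
  with k(2) have "(a, b) \<in> e \<or> (a + 1, b + 1) \<in> e"
      and "{(a, b), (a + 1, b + 1)} \<subseteq> tile_vertices k"
    by (auto simp: tile_edges_def tile_vertices_def)
  then have "e \<inter> tile_vertices k \<noteq> {}" by blast
  with k show "e \<inter> zigzag_vertices n \<noteq> {}" unfolding zigzag_vertices_def by blast
qed

text \<open>Library matrices are indexed from 0, so the entry \<open>(i, j)\<close> in 1-based indexing is at
  position \<open>(i - 1, j - 1)\<close>. The conditions on entries below are written with the 1-based indices.\<close>

definition R_mat :: "nat \<Rightarrow> nat \<Rightarrow> int mat" where
  "R_mat a b = mat (a + 1) (b + 1) (\<lambda>(i, j). if (i + 1) + (j + 1) \<le> b + 2 then 1 else 0)"

definition W_mat :: "nat \<Rightarrow> int mat" where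
  "W_mat a = mat (a + 1) (a + 1) (\<lambda>(i, j). if (i + 1) + (j + 1) = a + 2 then 1 else 0)"

definition L_mat :: "nat \<Rightarrow> nat \<Rightarrow> int mat" where
  "L_mat a b = W_mat a * R_mat a b"

text \<open>Only \<open>m 0, \<dots>, m n\<close> are used; the product is meant for \<open>n \<ge> 1\<close>, where the list of
  \<open>L\<close>-factors is indexed by \<open>1, \<dots>, n - 1\<close>.\<close>

definition X_mat :: "nat \<Rightarrow> (nat \<Rightarrow> nat) \<Rightarrow> int mat" where
  "X_mat n m = foldl (*) (R_mat (m 0) (m 0) * R_mat (m 0) (m 1))
     (map (\<lambda>k. L_mat (m k) (m (k + 1))) [1..<n])"

lemma R_mat_carrier: "R_mat a b \<in> carrier_mat (a + 1) (b + 1)"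
  unfolding R_mat_def by (rule mat_carrier)

lemma L_mat_carrier: "L_mat a b \<in> carrier_mat (a + 1) (b + 1)"
  unfolding L_mat_def W_mat_def by (rule mult_carrier_mat[OF mat_carrier R_mat_carrier])

lemma X_mat_carrier:
  assumes "n \<ge> 1"
  shows "X_mat n m \<in> carrier_mat (m 0 + 1) (m n + 1)"
  using assms
proof (induction n rule: nat_induct_at_least)
  case base
  show ?case
    using mult_carrier_mat[OF R_mat_carrier R_mat_carrier, of "m 0" "m 0" "m 1"]
    by (simp add: X_mat_def)
next
  case (Suc n)
  have "X_mat (Suc n) m = X_mat n m * L_mat (m n) (m (n + 1))"
    unfolding X_mat_def upt_Suc_append[OF Suc.hyps] map_append foldl_append by simp
  then show ?case
    using mult_carrier_mat[OF Suc.IH L_mat_carrier, of "m (n + 1)"]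
    by (simp only: Suc_eq_plus1)
qed

end

theory Submission
  imports Defs
begin

text \<open>Write the snake graph as a path \<open>u\<^sub>0, \<dots>, u\<^bsub>n+1\<^esub>\<close> (the staircase) together with one extra
  vertex \<open>w\<^sub>k\<close> for each tile \<open>T\<^bsub>k+1\<^esub>\<close>, \<open>k < n\<close>, adjacent to \<open>u\<^sub>k\<close> and \<open>u\<^bsub>k+2\<^esub>\<close>; then
  \<open>P\<^sub>k = {u\<^sub>k, w\<^sub>k}\<close> for \<open>k < n\<close> and \<open>P\<^sub>n = {u\<^sub>n, u\<^bsub>n+1\<^esub>}\<close>. For a cover with values \<open>b\<^sub>k\<close> on
  \<open>u\<^sub>k u\<^bsub>k+1\<^esub>\<close>, \<open>a\<^sub>k\<close> on \<open>u\<^sub>k w\<^sub>k\<close> and \<open>c\<^sub>k\<close> on \<open>w\<^sub>k u\<^bsub>k+2\<^esub>\<close>, comparing the conditions at \<open>u\<^sub>k\<close> and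
  \<open>w\<^sub>k\<close> gives \<open>c\<^sub>k = c\<^bsub>k-2\<^esub> + b\<^bsub>k-1\<^esub> + b\<^sub>k\<close>, so \<open>c\<^sub>k = b\<^sub>0 + \<dots> + b\<^sub>k\<close>. Hence covers correspond to
  chains \<open>s\<^sub>0 \<le> \<dots> \<le> s\<^sub>n = x\<^sub>n\<close> with \<open>s\<^sub>k \<le> x\<^sub>k\<close>. Splitting chains according to the value
  of \<open>s\<^bsub>n-1\<^esub>\<close> is multiplication by an \<open>L\<close>-matrix.\<close>

section \<open>Coordinates of the snake graph along its staircase\<close>

definition stair_vertex :: "nat \<Rightarrow> int \<times> int" where
  "stair_vertex k = (int (k div 2), int (Suc k div 2))"

text \<open>The corner of tile \<open>Suc k\<close> off the staircase: lower right for even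
  \<open>k\<close>, upper left for odd \<open>k\<close>.\<close>

definition outer_vertex :: "nat \<Rightarrow> int \<times> int" where
  "outer_vertex k =
     (if even k then (int (k div 2) + 1, int (k div 2)) else (int (k div 2), int (k div 2) + 2))"

definition stair_edge :: "nat \<Rightarrow> (int \<times> int) set" where
  "stair_edge k = {stair_vertex k, stair_vertex (Suc k)}"

definition pair_edge :: "nat \<Rightarrow> (int \<times> int) set" where
  "pair_edge k = {stair_vertex k, outer_vertex k}"

definition outer_edge :: "nat \<Rightarrow> (int \<times> int) set" where
  "outer_edge k = {outer_vertex k, stair_vertex (Suc (Suc k))}"

lemma stair_vertex_eq_iff [simp]: "stair_vertex k = stair_vertex l \<longleftrightarrow> k = l"
proof
  \<comment> \<open>The coordinates add up to the index, so the vertex determines it.\<close>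
  have sum: "k div 2 + Suc k div 2 = k" for k by presburger
  assume "stair_vertex k = stair_vertex l"
  then have "k div 2 = l div 2" "Suc k div 2 = Suc l div 2" by (simp_all add: stair_vertex_def)
  then show "k = l" using sum[of k] sum[of l] by metis
qed simp

lemma stair_outer_vertex_double [simp]:
  "stair_vertex (2 * j) = (int j, int j)" "stair_vertex (Suc (2 * j)) = (int j, int j + 1)"
  "outer_vertex (2 * j) = (int j + 1, int j)" "outer_vertex (Suc (2 * j)) = (int j, int j + 2)"
  by (simp_all add: stair_vertex_def outer_vertex_def)

text \<open>Parity split in the syntactic shape of the simp rules above, so that vertices and tiles
  become explicit coordinates.\<close>

lemma even_odd_Suc_cases:
  obtains j where "k = 2 * j" | j where "k = Suc (2 * j)"
proof -
  have "k = 2 * (k div 2) \<or> k = Suc (2 * (k div 2))" by presburger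
  then show ?thesis using that by blast
qed

lemma outer_vertex_eq_iff [simp]: "outer_vertex k = outer_vertex l \<longleftrightarrow> k = l"
  by (cases k rule: even_odd_Suc_cases; cases l rule: even_odd_Suc_cases) (auto, presburger+)

lemma stair_vertex_neq_outer_vertex [simp]:
  "stair_vertex k \<noteq> outer_vertex l" "outer_vertex l \<noteq> stair_vertex k"
  by (cases k rule: even_odd_Suc_cases; cases l rule: even_odd_Suc_cases; auto)+

lemma stair_vertex_double_plus_2 [simp]:
  "stair_vertex (Suc (Suc (2 * j))) = (int j + 1, int j + 1)"
  "stair_vertex (Suc (Suc (Suc (2 * j)))) = (int j + 1, int j + 2)"
  by (simp_all add: stair_vertex_def)

lemma inj_edges [simp]: "inj stair_edge" "inj pair_edge" "inj outer_edge"
  by (auto simp: inj_def stair_edge_def pair_edge_def outer_edge_def doubleton_eq_iff)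

text \<open>Stair edges contain no outer vertex. A pair edge and an outer edge with a common outer
  vertex have stair ends two indices apart.\<close>

lemma edges_neq [simp]:
  "stair_edge k \<noteq> pair_edge l" "pair_edge l \<noteq> stair_edge k"
  "stair_edge k \<noteq> outer_edge l" "outer_edge l \<noteq> stair_edge k"
  "pair_edge k \<noteq> outer_edge l" "outer_edge l \<noteq> pair_edge k"
  by (auto simp: stair_edge_def pair_edge_def outer_edge_def doubleton_eq_iff)

lemma tile_corner_Suc_double [simp]:
  "tile_corner (Suc (2 * j)) = (int j, int j)"
  "tile_corner (Suc (Suc (2 * j))) = (int j, int j + 1)"
  by (simp_all add: tile_corner_def Let_def)

lemma tile_vertices_Suc:
  "tile_vertices (Suc k) =
     {stair_vertex k, stair_vertex (Suc k), stair_vertex (Suc (Suc k)), outer_vertex k}"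
  by (cases k rule: even_odd_Suc_cases) (simp_all add: tile_vertices_def insert_commute add.commute)

lemma tile_edges_Suc:
  "tile_edges (Suc k) = {stair_edge k, stair_edge (Suc k), pair_edge k, outer_edge k}"
  by (cases k rule: even_odd_Suc_cases)
    (simp_all add: tile_edges_def stair_edge_def pair_edge_def outer_edge_def insert_commute
      add.commute)

lemma tile_pair_Suc: "tile_pair (Suc k) = {stair_vertex k, outer_vertex k}"
  by (cases k rule: even_odd_Suc_cases) (simp_all add: tile_pair_def Let_def add.commute)

lemma UN_tiles: "(\<Union>k\<in>{1..n}. f k) = (\<Union>k<n. f (Suc k))"
  by (simp only: image_Suc_lessThan[symmetric] image_image)

lemma zigzag_vertices_eq:
  assumes "n \<ge> 1"
  shows "zigzag_vertices n = stair_vertex ` {..Suc n} \<union> outer_vertex ` {..<n}"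
  using assms
proof (induction n rule: nat_induct_at_least)
  case base
  show ?case by (auto simp: zigzag_vertices_def UN_tiles tile_vertices_Suc atMost_Suc lessThan_Suc)
next
  case (Suc n)
  have "zigzag_vertices (Suc n) = zigzag_vertices n \<union> tile_vertices (Suc n)"
    unfolding zigzag_vertices_def UN_tiles lessThan_Suc by auto
  then show ?case
    using Suc.IH by (auto simp: tile_vertices_Suc atMost_Suc lessThan_Suc)
qed

lemma zigzag_edges_eq:
  assumes "n \<ge> 1"
  shows "zigzag_edges n = stair_edge ` {..n} \<union> pair_edge ` {..<n} \<union> outer_edge ` {..<n}"
  using assms
proof (induction n rule: nat_induct_at_least)
  case base
  show ?case by (auto simp: zigzag_edges_def UN_tiles tile_edges_Suc atMost_Suc lessThan_Suc)
next
  case (Suc n)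
  have "zigzag_edges (Suc n) = zigzag_edges n \<union> tile_edges (Suc n)"
    unfolding zigzag_edges_def UN_tiles lessThan_Suc by auto
  then show ?case
    using Suc.IH by (auto simp: tile_edges_Suc atMost_Suc lessThan_Suc)
qed

text \<open>The \<open>min\<close> arises because the last two stair vertices, with indices
  \<open>n\<close> and \<open>Suc n\<close>, both lie in the final pair.\<close>

lemma zigzag_label_stair_vertex:
  assumes "n \<ge> 1" "k \<le> Suc n"
  shows "zigzag_label n x (stair_vertex k) = x (min k n)"
proof (rule zigzag_label_eq)
  show "stair_vertex k \<in> zigzag_pair n (min k n)"
  proof (cases "k < n")
    case True
    then show ?thesis by (simp add: zigzag_pair_def tile_pair_Suc)
  next
    case False
    then have "min k n = n" by simp
    moreover have "stair_vertex k \<in> zigzag_vertices n"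
      using assms by (simp add: zigzag_vertices_eq)
    ultimately show ?thesis
      using False unfolding zigzag_pair_def UN_tiles by (auto simp: tile_pair_Suc)
  qed
qed simp

lemma zigzag_label_outer_vertex:
  assumes "k < n"
  shows "zigzag_label n x (outer_vertex k) = x k"
  using assms by (intro zigzag_label_eq) (simp_all add: zigzag_pair_def tile_pair_Suc)

section \<open>Vertex conditions of a cover\<close>

lemma sum_incident_edges:
  fixes \<omega> :: "(int \<times> int) set \<Rightarrow> nat"
  assumes "n \<ge> 1"
  shows "(\<Sum>e\<in>{e \<in> zigzag_edges n. v \<in> e}. \<omega> e) =
    (\<Sum>k\<le>n. if v \<in> stair_edge k then \<omega> (stair_edge k) else 0) +
    (\<Sum>k<n. if v \<in> pair_edge k then \<omega> (pair_edge k) else 0) +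
    (\<Sum>k<n. if v \<in> outer_edge k then \<omega> (outer_edge k) else 0)"
proof -
  let ?f = "\<lambda>e. if v \<in> e then \<omega> e else 0"
  have "(\<Sum>e\<in>{e \<in> zigzag_edges n. v \<in> e}. \<omega> e) = sum ?f (zigzag_edges n)"
    unfolding zigzag_edges_eq[OF assms] by (rule sum.inter_filter) simp
  also have "\<dots> = sum ?f (stair_edge ` {..n}) + sum ?f (pair_edge ` {..<n})
      + sum ?f (outer_edge ` {..<n})"
    unfolding zigzag_edges_eq[OF assms]
    by (subst sum.union_disjoint; (subst sum.union_disjoint)?) auto
  also have "\<dots> = (\<Sum>k\<le>n. ?f (stair_edge k)) + (\<Sum>k<n. ?f (pair_edge k))
      + (\<Sum>k<n. ?f (outer_edge k))"
    by (simp add: sum.reindex inj_on_subset[OF inj_edges(1)] inj_on_subset[OF inj_edges(2)]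
      inj_on_subset[OF inj_edges(3)])
  finally show ?thesis .
qed

lemma sum_incident_outer_vertex:
  fixes \<omega> :: "(int \<times> int) set \<Rightarrow> nat"
  assumes "k < n"
  shows "(\<Sum>e\<in>{e \<in> zigzag_edges n. outer_vertex k \<in> e}. \<omega> e) =
    \<omega> (pair_edge k) + \<omega> (outer_edge k)"
proof -
  have "n \<ge> 1" using assms by simp
  then show ?thesis
    using assms
    by (simp add: sum_incident_edges) (simp add: pair_edge_def outer_edge_def stair_edge_def)
qed

text \<open>The guards record which neighbours are missing at the two ends of the snake, and keep
  truncated subtraction from naming a wrong edge.\<close>

lemma sum_incident_stair_vertex:
  fixes \<omega> :: "(int \<times> int) set \<Rightarrow> nat"
  assumes "n \<ge> 1"
  shows "(\<Sum>e\<in>{e \<in> zigzag_edges n. stair_vertex i \<in> e}. \<omega> e) =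
    (if i \<le> n then \<omega> (stair_edge i) else 0)
    + (if 1 \<le> i \<and> i \<le> Suc n then \<omega> (stair_edge (i - 1)) else 0)
    + (if i < n then \<omega> (pair_edge i) else 0)
    + (if 2 \<le> i \<and> i \<le> Suc n then \<omega> (outer_edge (i - 2)) else 0)"
proof -
  \<comment> \<open>The two index conditions exclude each other, so the sum splits into two delta
    sums. Without \<open>1 \<le> i\<close>, the edge of index 0 would count twice at
    \<open>i = 0\<close>.\<close>
  have "(\<Sum>k\<le>n. if stair_vertex i \<in> stair_edge k then \<omega> (stair_edge k) else 0) =
      (\<Sum>k\<le>n. (if k = i then \<omega> (stair_edge k) else 0)
        + (if 1 \<le> i \<and> k = i - 1 then \<omega> (stair_edge k) else 0))"
    by (intro sum.cong refl) (auto simp: stair_edge_def)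
  also have "\<dots> = (if i \<le> n then \<omega> (stair_edge i) else 0)
    + (if 1 \<le> i \<and> i \<le> Suc n then \<omega> (stair_edge (i - 1)) else 0)"
    by (cases "1 \<le> i") (auto simp: sum.distrib)
  finally have 1: "(\<Sum>k\<le>n. if stair_vertex i \<in> stair_edge k then \<omega> (stair_edge k) else 0) = \<dots>" .
  have "(\<Sum>k<n. if stair_vertex i \<in> pair_edge k then \<omega> (pair_edge k) else 0) =
      (\<Sum>k<n. if k = i then \<omega> (pair_edge k) else 0)"
    by (intro sum.cong refl) (auto simp: pair_edge_def)
  then have 2: "(\<Sum>k<n. if stair_vertex i \<in> pair_edge k then \<omega> (pair_edge k) else 0) =
      (if i < n then \<omega> (pair_edge i) else 0)"
    by simp
  have "(\<Sum>k<n. if stair_vertex i \<in> outer_edge k then \<omega> (outer_edge k) else 0) =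
      (\<Sum>k<n. if 2 \<le> i \<and> k = i - 2 then \<omega> (outer_edge k) else 0)"
    by (intro sum.cong refl) (auto simp: outer_edge_def)
  also have "\<dots> = (if 2 \<le> i \<and> i \<le> Suc n then \<omega> (outer_edge (i - 2)) else 0)"
    by (cases "2 \<le> i") auto
  finally show ?thesis using 1 2 by (simp add: sum_incident_edges[OF assms])
qed

lemma zigzag_covers_iff:
  assumes n: "n \<ge> 1"
  shows "\<omega> \<in> zigzag_covers n x \<longleftrightarrow> \<omega> \<in> zigzag_edges n \<rightarrow>\<^sub>E UNIV \<and>
    (\<forall>k<n. \<omega> (pair_edge k) + \<omega> (outer_edge k) = x k) \<and>
    (\<forall>k<n. \<omega> (outer_edge k) = (\<Sum>i\<le>k. \<omega> (stair_edge i))) \<and>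
    (\<Sum>i\<le>n. \<omega> (stair_edge i)) = x n"
    (is "_ \<longleftrightarrow> ?E \<and> ?W \<and> ?C \<and> ?N")
proof -
  let ?a = "\<lambda>k. \<omega> (pair_edge k)" and ?b = "\<lambda>k. \<omega> (stair_edge k)" and ?c = "\<lambda>k. \<omega> (outer_edge k)"
  let ?d = "\<lambda>i. (if i \<le> n then ?b i else 0) + (if 1 \<le> i \<and> i \<le> Suc n then ?b (i - 1) else 0)
      + (if i < n then ?a i else 0) + (if 2 \<le> i \<and> i \<le> Suc n then ?c (i - 2) else 0)"
  let ?U = "\<forall>i\<le>Suc n. ?d i = x (min i n)"
  have "\<omega> \<in> zigzag_covers n x \<longleftrightarrow> ?E \<and> ?W \<and> ?U"
    unfolding zigzag_covers_def mixed_dimer_covers_def zigzag_vertices_eq[OF n] ball_Un ball_simps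
    by (auto simp: zigzag_label_outer_vertex zigzag_label_stair_vertex[OF n]
      sum_incident_outer_vertex sum_incident_stair_vertex[OF n] simp del: One_nat_def)
  also have "\<dots> \<longleftrightarrow> ?E \<and> ?W \<and> ?C \<and> ?N"
  proof (intro conj_cong refl)
    assume W: ?W
    \<comment> \<open>Only outer values of index below \<open>k\<close> are assumed, so this serves
      the strong induction for \<open>?C\<close> as well as the converse.\<close>
    have dC: "?d k = (\<Sum>i\<le>k. ?b i) + ?a k" if "k < n" "\<And>j. j < k \<Longrightarrow> ?c j = (\<Sum>i\<le>j. ?b i)" for k
    proof (cases "k < 2")
      case True
      with that show ?thesis by (auto simp: numeral_2_eq_2 less_Suc_eq)
    next
      case False
      then obtain l where "k = Suc (Suc l)" by (metis add_2_eq_Suc le_Suc_ex not_less)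
      with that show ?thesis by simp
    qed
    \<comment> \<open>Given \<open>?C\<close>, the conditions at the last two stair vertices
      coincide: both fix the total of the stair edges. Hence \<open>?N\<close> replaces two
      equations.\<close>
    have dN: "?d n = (\<Sum>i\<le>n. ?b i)" "?d (Suc n) = (\<Sum>i\<le>n. ?b i)" if C: ?C
    proof -
      show "?d n = (\<Sum>i\<le>n. ?b i)"
      proof (cases "n < 2")
        case True
        with n have "n = 1" by simp
        then show ?thesis by simp
      next
        case False
        then obtain l where "n = Suc (Suc l)" by (metis add_2_eq_Suc le_Suc_ex not_less)
        with C show ?thesis by simp
      qed
      obtain l where "n = Suc l" using n by (cases n) auto
      with C show "?d (Suc n) = (\<Sum>i\<le>n. ?b i)" by simp
    qed
    show "?U \<longleftrightarrow> ?C \<and> ?N"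
    proof
      assume U: ?U
      have "?c k = (\<Sum>i\<le>k. ?b i)" if "k < n" for k
        using that
      proof (induction k rule: less_induct)
        case (less k)
        then have "?d k = (\<Sum>i\<le>k. ?b i) + ?a k" by (intro dC) auto
        moreover have "?d k = x k" using U less.prems by (metis less_imp_le le_SucI min.absorb1)
        moreover have "?a k + ?c k = x k" using W less.prems by blast
        ultimately show ?case by linarith
      qed
      then have C: ?C by blast
      moreover have "?d n = x n" using U by (metis le_SucI min.idem order_refl)
      ultimately show "?C \<and> ?N" using dN(1) by simp
    next
      assume CN: "?C \<and> ?N"
      then have C: ?C by blast
      show ?U
      proof (intro allI impI)
        fix i assume "i \<le> Suc n"
        then consider "i < n" | "i = n" | "i = Suc n" by linarith
        then show "?d i = x (min i n)"
        proof cases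
          case 1
          then have "?d i = (\<Sum>j\<le>i. ?b j) + ?a i" using CN by (intro dC) auto
          also have "\<dots> = x i" using CN W 1 by (metis add.commute)
          finally show ?thesis using 1 by simp
        next
          case 2
          show ?thesis unfolding 2 dN(1)[OF C] min.idem using CN by blast
        next
          case 3
          have "min (Suc n) n = n" by simp
          then show ?thesis unfolding 3 dN(2)[OF C] using CN by simp
        qed
      qed
    qed
  qed
  finally show ?thesis .
qed

section \<open>Covers as bounded chains\<close>

text \<open>The bound \<open>s k \<le> x k\<close> leaves a non-negative value for the pair edge,
  and monotonicity does so for the stair edges.\<close>

definition bounded_chains :: "nat \<Rightarrow> (nat \<Rightarrow> nat) \<Rightarrow> (nat \<Rightarrow> nat) set" where
  "bounded_chains n x =
     {s \<in> {..n} \<rightarrow>\<^sub>E UNIV. s n = x n \<and> (\<forall>k<n. s k \<le> x k \<and> s k \<le> s (Suc k))}"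

lemma bij_betw_zigzag_covers_bounded_chains:
  assumes n: "n \<ge> 1"
  shows "bij_betw (\<lambda>\<omega>. \<lambda>k\<in>{..n}. \<Sum>i\<le>k. \<omega> (stair_edge i)) (zigzag_covers n x) (bounded_chains n x)"
    (is "bij_betw ?F _ _")
proof (rule bij_betw_imageI)
  show "inj_on ?F (zigzag_covers n x)"
  proof (rule inj_onI)
    fix \<omega> \<psi> assume \<omega>: "\<omega> \<in> zigzag_covers n x" and \<psi>: "\<psi> \<in> zigzag_covers n x" and eq: "?F \<omega> = ?F \<psi>"
    note cov = \<omega>[unfolded zigzag_covers_iff[OF n]] \<psi>[unfolded zigzag_covers_iff[OF n]]
    have S: "(\<Sum>i\<le>k. \<omega> (stair_edge i)) = (\<Sum>i\<le>k. \<psi> (stair_edge i))" if "k \<le> n" for k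
      using fun_cong[OF eq, of k] that by simp
    have b: "\<omega> (stair_edge k) = \<psi> (stair_edge k)" if "k \<le> n" for k
      using that S[of k] S[of "k - 1"] by (cases k) auto
    have c: "\<omega> (outer_edge k) = \<psi> (outer_edge k)" if "k < n" for k
      using that cov S[of k] by simp
    have a: "\<omega> (pair_edge k) = \<psi> (pair_edge k)" if "k < n" for k
      using that cov c[of k] by (metis add_right_cancel)
    show "\<omega> = \<psi>"
    proof (rule PiE_ext)
      show "\<omega> \<in> zigzag_edges n \<rightarrow>\<^sub>E UNIV" "\<psi> \<in> zigzag_edges n \<rightarrow>\<^sub>E UNIV" using cov by auto
      show "\<omega> e = \<psi> e" if "e \<in> zigzag_edges n" for e
        using that a b c by (auto simp: zigzag_edges_eq[OF n])
    qed
  qed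
  show "?F ` zigzag_covers n x = bounded_chains n x"
  proof (intro subset_antisym subsetI)
    fix s assume "s \<in> ?F ` zigzag_covers n x"
    then obtain \<omega> where \<omega>: "\<omega> \<in> zigzag_covers n x" and s: "s = ?F \<omega>" by blast
    have "(\<Sum>i\<le>k. \<omega> (stair_edge i)) \<le> x k" if "k < n" for k
      using \<omega> that unfolding zigzag_covers_iff[OF n] by (metis le_add2)
    then show "s \<in> bounded_chains n x"
      using \<omega> unfolding bounded_chains_def s zigzag_covers_iff[OF n] by auto
  next
    fix s assume s: "s \<in> bounded_chains n x"
    \<comment> \<open>The inverse map: differences of \<open>s\<close> on stair edges,
      \<open>x k - s k\<close> on pair edges, \<open>s k\<close> on outer edges. The chain
      conditions make these truncated subtractions exact.\<close>
    define \<omega> where "\<omega> = (\<lambda>e\<in>zigzag_edges n.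
      if e \<in> range stair_edge then
        (let k = inv_into UNIV stair_edge e in s k - (if k = 0 then 0 else s (k - 1)))
      else if e \<in> range pair_edge then (let k = inv_into UNIV pair_edge e in x k - s k)
      else s (inv_into UNIV outer_edge e))"
    have b: "\<omega> (stair_edge k) = s k - (if k = 0 then 0 else s (k - 1))" if "k \<le> n" for k
      using that by (simp add: \<omega>_def zigzag_edges_eq[OF n])
    have a: "\<omega> (pair_edge k) = x k - s k" if "k < n" for k
    proof -
      have "pair_edge k \<notin> range stair_edge" by auto
      with that show ?thesis by (simp add: \<omega>_def zigzag_edges_eq[OF n])
    qed
    have c: "\<omega> (outer_edge k) = s k" if "k < n" for k
    proof -
      have "outer_edge k \<notin> range stair_edge" "outer_edge k \<notin> range pair_edge" by auto
      with that show ?thesis by (simp add: \<omega>_def zigzag_edges_eq[OF n])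
    qed
    have S: "(\<Sum>i\<le>k. \<omega> (stair_edge i)) = s k" if "k \<le> n" for k
      using that
    proof (induction k)
      case 0
      then show ?case by (simp add: b)
    next
      case (Suc k)
      moreover have "s k \<le> s (Suc k)" using s Suc.prems by (simp add: bounded_chains_def)
      ultimately show ?case by (simp add: b)
    qed
    have "\<omega> \<in> zigzag_covers n x"
      unfolding zigzag_covers_iff[OF n]
      using s by (auto simp: a c S bounded_chains_def) (auto simp: \<omega>_def)
    moreover have "s = ?F \<omega>"
    proof
      fix k show "s k = ?F \<omega> k"
        using s by (cases "k \<le> n") (auto simp: S bounded_chains_def PiE_iff extensional_def)
    qed
    ultimately show "s \<in> ?F ` zigzag_covers n x" by blast
  qed
qed

lemma finite_bounded_chains: "finite (bounded_chains n x)"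
proof (rule finite_subset)
  show "bounded_chains n x \<subseteq> (\<Pi>\<^sub>E k\<in>{..n}. {..x k})"
  proof
    fix s assume s: "s \<in> bounded_chains n x"
    then have "s k \<le> x k" if "k \<le> n" for k
      using that by (cases "k = n") (auto simp: bounded_chains_def)
    with s show "s \<in> (\<Pi>\<^sub>E k\<in>{..n}. {..x k})" by (auto simp: bounded_chains_def PiE_iff)
  qed
qed (intro finite_PiE, auto)

lemma card_bounded_chains_0: "card (bounded_chains 0 x) = 1"
proof -
  have "bounded_chains 0 x = {\<lambda>k\<in>{..0}. x k}"
    by (auto simp: bounded_chains_def PiE_iff extensional_def fun_eq_iff)
  then show ?thesis by simp
qed

text \<open>Chains are sorted by \<open>t = s n\<close>: it obeys the bound at \<open>n\<close> and
  the final value above it, and becomes the prescribed end of the shorter chain.\<close>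

lemma card_bounded_chains_Suc:
  "card (bounded_chains (Suc n) x) =
     (\<Sum>t\<in>{t. t \<le> x n \<and> t \<le> x (Suc n)}. card (bounded_chains n (x(n := t))))"
proof -
  let ?T = "{t. t \<le> x n \<and> t \<le> x (Suc n)}"
  let ?G = "\<lambda>s. s(Suc n := x (Suc n))"
  \<comment> \<open>\<open>Suc n\<close> lies outside the domain of the shorter chain, so
    overwriting the default value there loses nothing and \<open>?G\<close> is injective.\<close>
  have out: "s (Suc n) = undefined" if "s \<in> bounded_chains n y" for s y
    using that by (auto simp: bounded_chains_def PiE_iff extensional_def)
  have inj: "inj_on ?G (bounded_chains n y)" for y
  proof (rule inj_onI)
    fix s s' assume *: "s \<in> bounded_chains n y" "s' \<in> bounded_chains n y" "?G s = ?G s'"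
    show "s = s'"
    proof
      fix k show "s k = s' k"
        using fun_cong[OF *(3), of k] out[OF *(1)] out[OF *(2)] by (cases "k = Suc n") auto
    qed
  qed
  have decomp: "bounded_chains (Suc n) x = (\<Union>t\<in>?T. ?G ` bounded_chains n (x(n := t)))"
  proof (intro subset_antisym subsetI)
    fix s assume s: "s \<in> bounded_chains (Suc n) x"
    have "s = ?G (restrict s {..n})"
      using s by (auto simp: bounded_chains_def PiE_iff extensional_def fun_eq_iff)
    moreover have "restrict s {..n} \<in> bounded_chains n (x(n := s n))"
      using s by (auto simp: bounded_chains_def)
    moreover have "s n \<in> ?T" using s by (auto simp: bounded_chains_def less_Suc_eq)
    ultimately show "s \<in> (\<Union>t\<in>?T. ?G ` bounded_chains n (x(n := t)))" by blast
  next
    fix s assume "s \<in> (\<Union>t\<in>?T. ?G ` bounded_chains n (x(n := t)))"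
    then obtain t s' where "t \<in> ?T" "s' \<in> bounded_chains n (x(n := t))" "s = ?G s'" by blast
    then show "s \<in> bounded_chains (Suc n) x"
      by (auto simp: bounded_chains_def PiE_iff extensional_def less_Suc_eq)
  qed
  have "card (bounded_chains (Suc n) x) = (\<Sum>t\<in>?T. card (?G ` bounded_chains n (x(n := t))))"
    unfolding decomp
  proof (rule card_UN_disjoint)
    show "finite ?T" by simp
    show "\<forall>t\<in>?T. finite (?G ` bounded_chains n (x(n := t)))"
      by (intro ballI finite_imageI finite_bounded_chains)
    show "\<forall>t\<in>?T. \<forall>t'\<in>?T. t \<noteq> t' \<longrightarrow>
        ?G ` bounded_chains n (x(n := t)) \<inter> ?G ` bounded_chains n (x(n := t')) = {}"
    proof (intro ballI impI)
      \<comment> \<open>The update at \<open>Suc n\<close> leaves the value at \<open>n\<close>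
        intact, so \<open>t\<close> can be read off from the extended chain.\<close>
      have "r n = t" if "r \<in> ?G ` bounded_chains n (x(n := t))" for r t
        using that by (auto simp: bounded_chains_def)
      then show "?G ` bounded_chains n (x(n := t)) \<inter> ?G ` bounded_chains n (x(n := t')) = {}"
        if "t \<noteq> t'" for t t'
        using that by blast
    qed
  qed
  also have "\<dots> = (\<Sum>t\<in>?T. card (bounded_chains n (x(n := t))))"
    by (simp only: card_image[OF inj])
  finally show ?thesis .
qed

section \<open>Matrix entries as chain counts\<close>

text \<open>Left multiplication by \<open>W_mat a\<close> moves row \<open>a - i\<close> of
  \<open>R_mat a b\<close> to row \<open>i\<close>.\<close>

lemma L_mat_index:
  assumes "i \<le> a" "j \<le> b"
  shows "L_mat a b $$ (i, j) = (if a - i + j \<le> b then 1 else 0)"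
proof -
  have "L_mat a b $$ (i, j) =
      (\<Sum>k<a + 1. (if i + k = a then 1 else 0) * (if k + j \<le> b then 1 else 0))"
    using assms by (simp add: L_mat_def W_mat_def R_mat_def scalar_prod_def atLeast0LessThan)
  also have "\<dots> = (\<Sum>k<a + 1. if k = a - i then (if k + j \<le> b then 1 else 0) else 0)"
    using assms by (intro sum.cong) auto
  also have "\<dots> = (if a - i + j \<le> b then 1 else 0)" by (subst sum.delta) auto
  finally show ?thesis .
qed

text \<open>Induction along the product. The column \<open>j\<close> stays arbitrary, since the next
  factor mixes all columns.\<close>

lemma X_mat_index:
  assumes "n \<ge> 1" "i \<le> m 0" "j \<le> m n"
  shows "X_mat n m $$ (i, j) = int (card (bounded_chains n (m(0 := m 0 - i, n := m n - j))))"
  using assms(1,3)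
proof (induction n arbitrary: j rule: nat_induct_at_least)
  case base
  \<comment> \<open>The summation index is the chain value \<open>s 0\<close>: the first factor
    bounds it by \<open>m 0 - i\<close>, the second by \<open>m 1 - j\<close>.\<close>
  have "X_mat 1 m $$ (i, j) =
      (\<Sum>k<m 0 + 1. (if i + k \<le> m 0 then 1 else 0) * (if k + j \<le> m 1 then 1 else 0))"
    using assms base by (simp add: X_mat_def R_mat_def scalar_prod_def atLeast0LessThan)
  also have "\<dots> = (\<Sum>k<m 0 + 1. if k \<le> m 0 - i \<and> k \<le> m 1 - j then 1 else 0)"
    using assms base by (intro sum.cong) auto
  also have "\<dots> = (\<Sum>k\<in>{k \<in> {..<m 0 + 1}. k \<le> m 0 - i \<and> k \<le> m 1 - j}. 1)"
    by (rule sum.inter_filter[symmetric]) simp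
  also have "{k \<in> {..<m 0 + 1}. k \<le> m 0 - i \<and> k \<le> m 1 - j} = {k. k \<le> m 0 - i \<and> k \<le> m 1 - j}"
    by auto
  finally show ?case by (simp add: card_bounded_chains_Suc card_bounded_chains_0)
next
  case (Suc n)
  let ?N = "\<lambda>t. int (card (bounded_chains n (m(0 := m 0 - i, n := t))))"
  have step: "X_mat (Suc n) m = X_mat n m * L_mat (m n) (m (Suc n))"
    unfolding X_mat_def upt_Suc_append[OF Suc.hyps] map_append foldl_append by simp
  have "X_mat (Suc n) m $$ (i, j) =
      (\<Sum>k<m n + 1. X_mat n m $$ (i, k) * L_mat (m n) (m (Suc n)) $$ (k, j))"
    using X_mat_carrier[OF Suc.hyps, of m] L_mat_carrier[of "m n" "m (Suc n)"] assms(2) Suc.prems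
    by (simp add: step scalar_prod_def atLeast0LessThan)
  \<comment> \<open>Column \<open>k\<close> counts chains ending at \<open>m n - k\<close>. The row
    reversal in \<open>L_mat\<close> makes its entry test this same value, so the sum can run over
    \<open>t = m n - k\<close>.\<close>
  also have "\<dots> = (\<Sum>k\<le>m n. ?N (m n - k) * (if m n - k + j \<le> m (Suc n) then 1 else 0))"
  proof (rule sum.cong)
    fix k assume "k \<in> {..m n}"
    then have "k \<le> m n" by simp
    then show "X_mat n m $$ (i, k) * L_mat (m n) (m (Suc n)) $$ (k, j) =
        ?N (m n - k) * (if m n - k + j \<le> m (Suc n) then 1 else 0)"
      by (simp only: Suc.IH L_mat_index Suc.prems)
  qed auto
  also have "\<dots> = (\<Sum>t\<le>m n. ?N t * (if t + j \<le> m (Suc n) then 1 else 0))"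
    by (rule sum.nat_diff_reindex[of _ "Suc (m n)", unfolded lessThan_Suc_atMost, simplified])
  also have "\<dots> = (\<Sum>t\<le>m n. if t \<le> m (Suc n) - j then ?N t else 0)"
    using Suc.prems by (intro sum.cong) auto
  also have "\<dots> = (\<Sum>t\<in>{t \<in> {..m n}. t \<le> m (Suc n) - j}. ?N t)"
    by (rule sum.inter_filter[symmetric]) simp
  also have "\<dots> = int (card (bounded_chains (Suc n) (m(0 := m 0 - i, Suc n := m (Suc n) - j))))"
  proof -
    let ?x = "m(0 := m 0 - i, Suc n := m (Suc n) - j)"
    \<comment> \<open>Chains on \<open>{..n}\<close> never read the label at
      \<open>Suc n\<close>.\<close>
    have "bounded_chains n (?x(n := t)) = bounded_chains n (m(0 := m 0 - i, n := t))" for t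
      by (auto simp: bounded_chains_def)
    \<comment> \<open>As \<open>n \<ge> 1\<close>, the lowering at 0 does not touch the bound at
      \<open>n\<close>, so \<open>t\<close> ranges up to \<open>m n\<close>.\<close>
    then show ?thesis using Suc.hyps by (simp add: card_bounded_chains_Suc)
  qed
  finally show ?case .
qed

theorem theorem6:
  fixes n :: nat and m :: "nat \<Rightarrow> nat"
  assumes "n \<ge> 1"
  shows "(\<forall>i\<in>{1..m 0 + 1}. \<forall>j\<in>{1..m n + 1}.
            X_mat n m $$ (i - 1, j - 1) =
              int (card (zigzag_covers n (m(0 := m 0 + 1 - i, n := m n + 1 - j)))))
         \<and> X_mat n m $$ (0, 0) = int (card (zigzag_covers n m))"
proof -
  have card: "card (zigzag_covers n x) = card (bounded_chains n x)" for x
    by (rule bij_betw_same_card[OF bij_betw_zigzag_covers_bounded_chains[OF assms]])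
  have "X_mat n m $$ (i - 1, j - 1) =
      int (card (zigzag_covers n (m(0 := m 0 + 1 - i, n := m n + 1 - j))))"
    if "i \<in> {1..m 0 + 1}" "j \<in> {1..m n + 1}" for i j
  proof -
    have "m 0 + 1 - i = m 0 - (i - 1)" "m n + 1 - j = m n - (j - 1)" using that by auto
    moreover have "i - 1 \<le> m 0" "j - 1 \<le> m n" using that by auto
    ultimately show ?thesis using X_mat_index[OF assms, of "i - 1" m "j - 1"] by (simp only: card)
  qed
  moreover have "X_mat n m $$ (0, 0) = int (card (zigzag_covers n m))"
    using X_mat_index[OF assms, of 0 m 0] by (simp add: card)
  ultimately show ?thesis by blast
qed

end
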